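(* Let $\varrho^{-1}$ be a simple Pisot number, i.e. $\varrho^{-1}>1$ has minimal polynomial $x^k-x^{k-1}-\cdots-x-1$ for some integer $k\ge2$. Let $0<p<1$ with $p\ne 1-p$, and let $\mu$ be the Bernoulli convolution satisfying $$\mu=p\,\mu\circ S_0^{-1}+(1-p)\,\mu\circ S_1^{-1},\qquad S_0(x)=\varrho x,\quad S_1(x)=\varrho x+(1-\varrho).$$ Then the set of local dimensions $\{\dim_{loc}\mu(x): x\in[0,1],\ \text{the local dimension at } x \text{ exists}\}$ has an isolated point: if $p<1-p$ then $\dim_{loc}\mu(0)$ is an isolated point of this set, and if $1-p<p$ then $\dim_{loc}\mu(1)$ is an isolated point of this set.
   Context: $\mu$ is the unique Borel probability measure satisfying the displayed identity; its support is $[0,1]$. The local dimension of $\mu$ at $x$ is $\dim_{loc}\mu(x)=\lim_{r\to0^+}\frac{\log\mu([x-r,x+r])}{\log r}$ when the limit exists. *)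

theory Defs
  imports "HOL-Probability.Probability" "HOL-Computational_Algebra.Polynomial"
begin

definition is_min_poly :: "rat poly \<Rightarrow> real \<Rightarrow> bool" where
  "is_min_poly q x \<longleftrightarrow>
     lead_coeff q = 1 \<and> poly (map_poly of_rat q) x = 0 \<and>
     (\<forall>r. r \<noteq> 0 \<and> poly (map_poly of_rat r) x = 0 \<longrightarrow> degree q \<le> degree r)"

definition simple_pisot :: "real \<Rightarrow> bool" where
  "simple_pisot \<beta> \<longleftrightarrow>
     \<beta> > 1 \<and> (\<exists>k::nat. k \<ge> 2 \<and> is_min_poly (monom 1 k - (\<Sum>i<k. monom 1 i)) \<beta>)"

definition S0 :: "real \<Rightarrow> real \<Rightarrow> real" where
  "S0 \<rho> x = \<rho> * x"

definition S1 :: "real \<Rightarrow> real \<Rightarrow> real" where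
  "S1 \<rho> x = \<rho> * x + (1 - \<rho>)"

definition bernoulli_convolution :: "real \<Rightarrow> real \<Rightarrow> real measure \<Rightarrow> bool" where
  "bernoulli_convolution \<rho> p \<mu> \<longleftrightarrow>
     real_distribution \<mu> \<and>
     (\<forall>A \<in> sets borel.
        measure \<mu> A = p * measure \<mu> (S0 \<rho> -` A) + (1 - p) * measure \<mu> (S1 \<rho> -` A))"

definition has_local_dim :: "real measure \<Rightarrow> real \<Rightarrow> real \<Rightarrow> bool" where
  "has_local_dim \<mu> x d \<longleftrightarrow>
     ((\<lambda>r. ln (measure \<mu> {x - r..x + r}) / ln r) \<longlongrightarrow> d) (at_right 0)"

definition local_dim_exists :: "real measure \<Rightarrow> real \<Rightarrow> bool" where
  "local_dim_exists \<mu> x \<longleftrightarrow> (\<exists>d. has_local_dim \<mu> x d)"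

(* Limits are unique, so this is the limit whenever local_dim_exists holds,
   and an unspecified real otherwise. *)
definition local_dim :: "real measure \<Rightarrow> real \<Rightarrow> real" where
  "local_dim \<mu> x = (THE d. has_local_dim \<mu> x d)"

(* The points range over [0,1], the support of the Bernoulli convolutions considered here;
   off the support the convention ln 0 = 0 would make the quotient meaningless. *)
definition local_dims :: "real measure \<Rightarrow> real set" where
  "local_dims \<mu> = {local_dim \<mu> x | x. x \<in> {0..1} \<and> local_dim_exists \<mu> x}"

end

theory Submission
  imports Defs "HOL-Real_Asymp.Real_Asymp"
begin

text \<open>
  By the reflection \<open>x \<mapsto> 1 - x\<close> we may assume \<open>p < 1 - p\<close>. Near \<open>0\<close> only the branch \<open>S0\<close>
  contributes, so \<open>\<mu>[-r,r] = p \<mu>[-r/\<rho>,r/\<rho>]\<close> for small \<open>r\<close> and the local dimension at \<open>0\<close>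
  is \<open>ln p / ln \<rho>\<close>. For \<open>x \<in> (0,1]\<close> follow the lazy expansion of \<open>x\<close>, which uses the
  digit \<open>1\<close> only at points above \<open>\<rho>\<close>. Such a point is moved above \<open>(2\<rho> - 1)/\<rho> = \<rho>^k\<close>, so
  after the first \<open>1\<close> every \<open>k\<close> consecutive digits contain a \<open>1\<close>. Hence
  \<open>\<mu>[x-r,x+r]\<close> with \<open>r = 2\<rho>^n\<close> is at least a constant times \<open>(p q)^n\<close> with
  \<open>q^k = (1-p)/p > 1\<close>, and the local dimension at \<open>x\<close> is at most
  \<open>ln (p q) / ln \<rho> < ln p / ln \<rho>\<close>.
\<close>

section \<open>The algebraic equation satisfied by \<open>\<rho>\<close>\<close>

text \<open>Multiplying the minimal equation of \<open>\<beta> = 1/\<rho>\<close> by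
  \<open>\<beta> - 1\<close> telescopes the geometric sum to
  \<open>\<beta>^(k+1) = 2 * \<beta>^k - 1\<close>; multiplication by \<open>\<rho>^(k+1)\<close>
  then gives the stated form.\<close>

lemma simple_pisot_inverse_root:
  assumes "simple_pisot (inverse \<rho>)"
  obtains k :: nat where "k \<ge> 2" "0 < \<rho>" "\<rho> < 1" "\<rho> ^ (k + 1) = 2 * \<rho> - 1"
proof -
  define \<beta> where "\<beta> = inverse \<rho>"
  have b: "\<beta> > 1" using assms by (simp add: simple_pisot_def \<beta>_def)
  from assms obtain k where k: "k \<ge> 2" and
    mp: "is_min_poly (monom 1 k - (\<Sum>i<k. monom 1 i)) \<beta>"
    unfolding simple_pisot_def \<beta>_def by blast
  have "poly (map_poly of_rat (monom 1 k - (\<Sum>i<k. monom 1 i))) \<beta> = 0"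
    using mp by (simp add: is_min_poly_def)
  moreover have "map_poly (of_rat :: rat \<Rightarrow> real) (monom 1 k - (\<Sum>i<k. monom 1 i))
      = monom 1 k - (\<Sum>i<k. monom 1 i)"
    by (rule poly_eqI) (simp add: coeff_map_poly coeff_sum of_rat_diff of_rat_sum if_distrib cong: if_cong)
  ultimately have root: "\<beta> ^ k = (\<Sum>i<k. \<beta> ^ i)"
    by (simp add: poly_sum poly_monom)
  have "(\<beta> - 1) * \<beta> ^ k = \<beta> ^ k - 1"
    using root by (metis power_diff_1_eq)
  then have e: "\<beta> * \<beta> ^ k = 2 * \<beta> ^ k - 1" by (simp add: algebra_simps)
  have r: "0 < \<rho>" "\<rho> < 1"
    using b unfolding \<beta>_def by (auto simp: one_less_inverse_iff)
  have rb: "\<rho> ^ k * \<beta> ^ k = 1" "\<rho> * \<beta> = 1"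
    using r by (simp_all add: \<beta>_def flip: power_mult_distrib)
  have "(\<rho> * \<rho> ^ k) * (\<beta> * \<beta> ^ k) = (\<rho> * \<rho> ^ k) * (2 * \<beta> ^ k - 1)" using e by simp
  moreover have "(\<rho> * \<rho> ^ k) * (\<beta> * \<beta> ^ k) = (\<rho> ^ k * \<beta> ^ k) * (\<rho> * \<beta>)"
    by (simp add: algebra_simps)
  moreover have "(\<rho> * \<rho> ^ k) * (2 * \<beta> ^ k - 1) = 2 * \<rho> * (\<rho> ^ k * \<beta> ^ k) - \<rho> * \<rho> ^ k"
    by (simp add: algebra_simps)
  ultimately have "\<rho> ^ (k + 1) = 2 * \<rho> - 1" using rb by simp
  with k r that show thesis by blast
qed

section \<open>From geometric sequences of radii to power laws and logarithmic limits\<close>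

lemma obtain_power_scale:
  fixes \<rho> A r :: real
  assumes "0 < \<rho>" "\<rho> < 1" "0 < r" "r \<le> A"
  obtains n where "A * \<rho> ^ Suc n < r" "r \<le> A * \<rho> ^ n"
proof -
  \<comment> \<open>The first grid radius below \<open>r\<close>; its index is positive because
    \<open>r \<le> A\<close>, so it has a predecessor.\<close>
  define m where "m = (LEAST m. A * \<rho> ^ m < r)"
  obtain m0 where "\<rho> ^ m0 < r / A"
    using real_arch_pow_inv[of "r / A" \<rho>] assms by auto
  then have "A * \<rho> ^ m0 < r" using assms by (simp add: field_simps)
  then have m: "A * \<rho> ^ m < r" unfolding m_def by (rule LeastI)
  then have "m \<noteq> 0" using assms(4) by (cases m) auto
  then obtain n where n: "m = Suc n" by (cases m) auto
  have "\<not> A * \<rho> ^ n < r"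
    using not_less_Least[of n "\<lambda>m. A * \<rho> ^ m < r"] n m_def by auto
  with m n that show thesis by auto
qed

lemma power_eq_powr_log:
  fixes \<rho> l :: real
  assumes "0 < \<rho>" "\<rho> < 1" "0 < l"
  shows "l ^ n = (\<rho> ^ n) powr (ln l / ln \<rho>)"
proof -
  have "(\<rho> ^ n) powr (ln l / ln \<rho>) = exp (real n * ln l)"
    using assms by (simp add: powr_def ln_realpow)
  then show ?thesis using assms by (simp add: exp_of_nat_mult)
qed

text \<open>The exponent \<open>e = ln l / ln \<rho>\<close> is the one with
  \<open>\<rho> powr e = l\<close>. Monotonicity compares \<open>r\<close> with the first grid
  radius below it, which is at least \<open>\<rho> * r\<close>; the lost factor goes into
  \<open>C\<close>.\<close>

lemma power_law_lower:
  fixes f :: "real \<Rightarrow> real" and \<rho> l c A :: real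
  assumes "mono f" "0 < \<rho>" "\<rho> < 1" "0 < l" "l \<le> 1" "0 < c" "0 < A"
    and bound: "\<And>n. c * l ^ n \<le> f (A * \<rho> ^ n)"
  obtains C where "C > 0" "\<And>r. 0 < r \<Longrightarrow> r \<le> A \<Longrightarrow> C * r powr (ln l / ln \<rho>) \<le> f r"
proof
  let ?e = "ln l / ln \<rho>"
  have e: "?e \<ge> 0" using assms by (intro divide_nonpos_nonpos) auto
  show "c * (\<rho> / A) powr ?e > 0" using assms by simp
  fix r :: real assume r: "0 < r" "r \<le> A"
  obtain n where n: "A * \<rho> ^ Suc n < r" "r \<le> A * \<rho> ^ n"
    using obtain_power_scale[OF assms(2,3) r] .
  have "\<rho> / A * r \<le> \<rho> ^ Suc n" using n assms by (simp add: field_simps)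
  then have "(\<rho> / A * r) powr ?e \<le> (\<rho> ^ Suc n) powr ?e"
    using r assms e by (intro powr_mono2) auto
  also have "\<dots> = l ^ Suc n" by (rule power_eq_powr_log[symmetric]) fact+
  finally have "(\<rho> / A * r) powr ?e \<le> l ^ Suc n" .
  then have "c * (\<rho> / A * r) powr ?e \<le> c * l ^ Suc n"
    using assms(6) by (intro mult_left_mono) auto
  also have "\<dots> \<le> f (A * \<rho> ^ Suc n)" by (rule bound)
  also have "\<dots> \<le> f r" using n assms(1) by (intro monoD[of f]) auto
  finally have "c * (\<rho> / A * r) powr ?e \<le> f r" .
  moreover have "(\<rho> / A * r) powr ?e = (\<rho> / A) powr ?e * r powr ?e"
    using assms r by (subst powr_mult) auto
  ultimately show "c * (\<rho> / A) powr ?e * r powr ?e \<le> f r"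
    by (simp add: mult.assoc)
qed

text \<open>Here the comparison is with the grid radius just above \<open>r\<close>, which is less
  than \<open>r / \<rho>\<close>.\<close>

lemma power_law_upper:
  fixes f :: "real \<Rightarrow> real" and \<rho> l c A :: real
  assumes "mono f" "0 < \<rho>" "\<rho> < 1" "0 < l" "l \<le> 1" "0 < c" "0 < A"
    and bound: "\<And>n. f (A * \<rho> ^ n) \<le> c * l ^ n"
  obtains C where "C > 0" "\<And>r. 0 < r \<Longrightarrow> r \<le> A \<Longrightarrow> f r \<le> C * r powr (ln l / ln \<rho>)"
proof
  let ?e = "ln l / ln \<rho>"
  have e: "?e \<ge> 0" using assms by (intro divide_nonpos_nonpos) auto
  show "c * (1 / (A * \<rho>)) powr ?e > 0" using assms by simp
  fix r :: real assume r: "0 < r" "r \<le> A"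
  obtain n where n: "A * \<rho> ^ Suc n < r" "r \<le> A * \<rho> ^ n"
    using obtain_power_scale[OF assms(2,3) r] .
  have "\<rho> ^ n \<le> 1 / (A * \<rho>) * r" using n assms by (simp add: field_simps)
  then have "(\<rho> ^ n) powr ?e \<le> (1 / (A * \<rho>) * r) powr ?e"
    using r assms e by (intro powr_mono2) auto
  moreover have "l ^ n = (\<rho> ^ n) powr ?e" by (rule power_eq_powr_log) fact+
  ultimately have le: "l ^ n \<le> (1 / (A * \<rho>) * r) powr ?e" by simp
  have "f r \<le> f (A * \<rho> ^ n)" using n assms(1) by (intro monoD[of f]) auto
  also have "\<dots> \<le> c * l ^ n" by (rule bound)
  also have "\<dots> \<le> c * (1 / (A * \<rho>) * r) powr ?e"
    using le assms(6) by (intro mult_left_mono) auto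
  also have "\<dots> = c * (1 / (A * \<rho>)) powr ?e * r powr ?e"
    using assms r by (subst powr_mult) auto
  finally show "f r \<le> c * (1 / (A * \<rho>)) powr ?e * r powr ?e" .
qed

lemma log_power_law_tendsto:
  fixes C e :: real
  assumes "C > 0"
  shows "((\<lambda>r. ln (C * r powr e) / ln r) \<longlongrightarrow> e) (at_right 0)"
proof -
  \<comment> \<open>The constant only contributes \<open>ln C / ln r\<close>, which vanishes because
    \<open>ln r\<close> tends to minus infinity.\<close>
  have "((\<lambda>r. (ln C + e * ln r) / ln r) \<longlongrightarrow> e) (at_right 0)"
    by real_asymp
  moreover have "\<forall>\<^sub>F r in at_right 0. (ln C + e * ln r) / ln r = ln (C * r powr e) / ln r"
    using eventually_at_right_less[of 0]
    by eventually_elim (use assms in \<open>simp add: ln_mult ln_powr\<close>)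
  ultimately show ?thesis by (rule Lim_transform_eventually)
qed

text \<open>For \<open>r < 1\<close> the denominator \<open>ln r\<close> is negative, so a lower
  bound on \<open>f\<close> becomes an upper bound on the quotient.\<close>

lemma eventually_log_quotient_le:
  fixes f :: "real \<Rightarrow> real"
  assumes "C > 0" "A > 0" "\<And>r. 0 < r \<Longrightarrow> r \<le> A \<Longrightarrow> C * r powr e \<le> f r"
  shows "\<forall>\<^sub>F r in at_right 0. ln (f r) / ln r \<le> ln (C * r powr e) / ln r"
proof -
  have "\<forall>\<^sub>F r in at_right 0. r < min A 1"
    using assms by (intro eventually_at_rightI[of 0 "min A 1"]) auto
  then show ?thesis
    using eventually_at_right_less[of 0]
  proof eventually_elim
    case (elim r)
    have "0 < C * r powr e" using assms elim by simp
    then have "ln (C * r powr e) \<le> ln (f r)"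
      using assms(3)[of r] elim by (intro ln_mono) auto
    then show ?case using elim by (intro divide_right_mono_neg) auto
  qed
qed

lemma eventually_log_quotient_ge:
  fixes f :: "real \<Rightarrow> real"
  assumes "A > 0" "\<And>r. 0 < r \<Longrightarrow> r \<le> A \<Longrightarrow> 0 < f r"
    and "\<And>r. 0 < r \<Longrightarrow> r \<le> A \<Longrightarrow> f r \<le> C * r powr e"
  shows "\<forall>\<^sub>F r in at_right 0. ln (C * r powr e) / ln r \<le> ln (f r) / ln r"
proof -
  have "\<forall>\<^sub>F r in at_right 0. r < min A 1"
    using assms by (intro eventually_at_rightI[of 0 "min A 1"]) auto
  then show ?thesis
    using eventually_at_right_less[of 0]
  proof eventually_elim
    case (elim r)
    then have "ln (f r) \<le> ln (C * r powr e)"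
      using assms(2,3)[of r] by (intro ln_mono) auto
    then show ?case using elim by (intro divide_right_mono_neg) auto
  qed
qed

lemma local_dim_eq: "has_local_dim \<mu> x d \<Longrightarrow> local_dim \<mu> x = d"
  unfolding local_dim_def has_local_dim_def
  by (intro the_equality) (auto intro: tendsto_unique[OF trivial_limit_at_right_real])

section \<open>Self-similarity and concentration of the measure near [0,1]\<close>

lemma S_vimage_borel:
  assumes "A \<in> sets borel"
  shows "S0 \<rho> -` A \<in> sets borel" "S1 \<rho> -` A \<in> sets borel"
proof -
  have "S0 \<rho> \<in> borel_measurable borel" "S1 \<rho> \<in> borel_measurable borel"
    unfolding S0_def[abs_def] S1_def[abs_def] by measurable
  from this[THEN measurable_sets, OF assms]
  show "S0 \<rho> -` A \<in> sets borel" "S1 \<rho> -` A \<in> sets borel" by simp_all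
qed

locale biased_convolution =
  fixes \<rho> p :: real and \<mu> :: "real measure"
  assumes \<rho>: "0 < \<rho>" "\<rho> < 1" and p: "0 < p" "p < 1"
    and conv: "bernoulli_convolution \<rho> p \<mu>"
begin

sublocale real_distribution \<mu>
  using conv by (simp add: bernoulli_convolution_def)

lemma measure_split:
  "A \<in> sets borel \<Longrightarrow>
     measure \<mu> A = p * measure \<mu> (S0 \<rho> -` A) + (1 - p) * measure \<mu> (S1 \<rho> -` A)"
  using conv by (simp add: bernoulli_convolution_def)

text \<open>By self-similarity the mass of \<open>E n\<close> is an average of masses of subsets of
  \<open>E (Suc n)\<close>, so the masses increase with \<open>n\<close>. They also tend to 0 by
  continuity from above, so all of them vanish.\<close>

lemma measure_zero_of_expanding:
  assumes sets: "\<And>n. E n \<in> sets borel"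
    and S0: "\<And>n. S0 \<rho> -` E n \<subseteq> E (Suc n)" and S1: "\<And>n. S1 \<rho> -` E n \<subseteq> E (Suc n)"
    and dec: "decseq E" and empty: "(\<Inter>n. E n) = {}"
  shows "measure \<mu> (E 0) = 0"
proof -
  have step: "measure \<mu> (E n) \<le> measure \<mu> (E (Suc n))" for n
  proof -
    have "measure \<mu> (S0 \<rho> -` E n) \<le> measure \<mu> (E (Suc n))"
      "measure \<mu> (S1 \<rho> -` E n) \<le> measure \<mu> (E (Suc n))"
      using sets by (auto intro!: finite_measure_mono S0 S1)
    then have "p * measure \<mu> (S0 \<rho> -` E n) + (1 - p) * measure \<mu> (S1 \<rho> -` E n)
        \<le> p * measure \<mu> (E (Suc n)) + (1 - p) * measure \<mu> (E (Suc n))"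
      using p by (intro add_mono mult_left_mono) auto
    then show ?thesis
      using measure_split[OF sets[of n]] by (simp add: algebra_simps)
  qed
  have "measure \<mu> (E 0) \<le> measure \<mu> (E n)" for n
    using lift_Suc_mono_le[of "\<lambda>n. measure \<mu> (E n)", OF step] by simp
  moreover have "(\<lambda>n. measure \<mu> (E n)) \<longlonglongrightarrow> measure \<mu> (\<Inter>n. E n)"
    using sets dec by (intro finite_Lim_measure_decseq) auto
  ultimately have "measure \<mu> (E 0) \<le> 0"
    using empty by (intro LIMSEQ_le_const[of "\<lambda>n. measure \<mu> (E n)"]) auto
  then show ?thesis by (simp add: measure_le_0_iff)
qed

lemma escape:
  assumes "t > 0" shows "\<exists>n. x < t / \<rho> ^ n"
proof -
  obtain n where "\<rho> ^ n < t / (\<bar>x\<bar> + 1)"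
    using real_arch_pow_inv[of "t / (\<bar>x\<bar> + 1)" \<rho>] assms \<rho> by auto
  then have "\<bar>x\<bar> + 1 < t / \<rho> ^ n"
    using \<rho> assms by (simp add: field_simps)
  then show ?thesis by (intro exI[of _ n]) linarith
qed

lemma scale_mono: "t > 0 \<Longrightarrow> m \<le> n \<Longrightarrow> t / \<rho> ^ m \<le> t / \<rho> ^ n"
  using \<rho> by (intro divide_left_mono power_decreasing mult_pos_pos) auto

text \<open>The inverses of both maps push a point left of 0 away from 0 by a factor of at least
  \<open>1 / \<rho>\<close>, so the half-lines ending at \<open>- (t / \<rho>^n)\<close> are
  expanding in the sense above.\<close>

lemma measure_left_zero:
  assumes "t > 0" shows "measure \<mu> {..< - t} = 0"
proof -
  let ?E = "\<lambda>n. {..< - (t / \<rho> ^ n)}"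
  have "measure \<mu> (?E 0) = 0"
  proof (rule measure_zero_of_expanding)
    show "S0 \<rho> -` ?E n \<subseteq> ?E (Suc n)" for n
      using \<rho> by (auto simp: S0_def field_simps)
    show "S1 \<rho> -` ?E n \<subseteq> ?E (Suc n)" for n
    proof
      fix x assume "x \<in> S1 \<rho> -` ?E n"
      then have "\<rho> * x < - (t / \<rho> ^ n)" using \<rho> by (simp add: S1_def)
      then show "x \<in> ?E (Suc n)" using \<rho> by (simp add: field_simps)
    qed
    show "decseq ?E"
      using scale_mono[OF assms] by (force simp: decseq_def)
    have "\<exists>n. \<not> x < - (t / \<rho> ^ n)" for x
      using escape[OF assms, of "-x"] by (auto simp: not_less intro: less_imp_le)
        (smt (verit))
    then show "(\<Inter>n. ?E n) = {}" by auto
  qed auto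
  then show ?thesis by simp
qed

lemma measure_right_zero:
  assumes "t > 0" shows "measure \<mu> {1 + t <..} = 0"
proof -
  let ?E = "\<lambda>n. {1 + t / \<rho> ^ n <..}"
  have "measure \<mu> (?E 0) = 0"
  proof (rule measure_zero_of_expanding)
    show "S0 \<rho> -` ?E n \<subseteq> ?E (Suc n)" for n
    proof
      fix x assume "x \<in> S0 \<rho> -` ?E n"
      then have "\<rho> + t / \<rho> ^ n < \<rho> * x" using \<rho> by (simp add: S0_def)
      then show "x \<in> ?E (Suc n)" using \<rho> by (simp add: field_simps)
    qed
    show "S1 \<rho> -` ?E n \<subseteq> ?E (Suc n)" for n
    proof
      fix x assume "x \<in> S1 \<rho> -` ?E n"
      then have "\<rho> + t / \<rho> ^ n < \<rho> * x" using \<rho> by (simp add: S1_def)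
      then show "x \<in> ?E (Suc n)" using \<rho> by (simp add: field_simps)
    qed
    show "decseq ?E"
      using scale_mono[OF assms] by (force simp: decseq_def)
    have "\<exists>n. \<not> x > 1 + t / \<rho> ^ n" for x
      using escape[OF assms, of x] by (smt (verit))
    then show "(\<Inter>n. ?E n) = {}" by auto
  qed auto
  then show ?thesis by simp
qed

text \<open>Base case of the inductions below: radius 2 around any point of [0,1] captures all the
  mass, which is why the radii there have the form \<open>2 * \<rho>^n\<close>.\<close>

lemma measure_large_interval:
  assumes "a \<le> -1" "2 \<le> b" shows "measure \<mu> {a..b} = 1"
proof -
  have "1 = measure \<mu> UNIV" using prob_space by simp
  also have "\<dots> \<le> measure \<mu> ({..< -1} \<union> ({a..b} \<union> {1 + 1 <..}))"
    using assms by (intro finite_measure_mono) auto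
  also have "\<dots> \<le> measure \<mu> {..< -1} + (measure \<mu> {a..b} + measure \<mu> {1 + 1 <..})"
    by (intro order_trans[OF measure_Un_le] add_left_mono) auto
  also have "\<dots> = measure \<mu> {a..b}"
    using measure_left_zero[of 1] measure_right_zero[of 1] by simp
  finally show ?thesis using prob_le_1[of "{a..b}"] by simp
qed

text \<open>Both preimages are kept in centre-radius form, so that the identity can be iterated
  along a digit expansion of the centre.\<close>

lemma interval_split:
  "measure \<mu> {x - r..x + r} =
     p * measure \<mu> {x / \<rho> - r / \<rho>..x / \<rho> + r / \<rho>} +
     (1 - p) * measure \<mu> {(x - (1 - \<rho>)) / \<rho> - r / \<rho>..(x - (1 - \<rho>)) / \<rho> + r / \<rho>}"
proof -
  have "S0 \<rho> -` {x - r..x + r} = {x / \<rho> - r / \<rho>..x / \<rho> + r / \<rho>}"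
    using \<rho> by (auto simp: S0_def field_simps)
  moreover have "S1 \<rho> -` {x - r..x + r} =
      {(x - (1 - \<rho>)) / \<rho> - r / \<rho>..(x - (1 - \<rho>)) / \<rho> + r / \<rho>}"
  proof -
    have "x - r \<le> S1 \<rho> y \<longleftrightarrow> (x - (1 - \<rho>)) / \<rho> - r / \<rho> \<le> y" for y
      using \<rho> by (simp add: S1_def pos_divide_le_eq mult.commute flip: diff_divide_distrib) linarith
    moreover have "S1 \<rho> y \<le> x + r \<longleftrightarrow> y \<le> (x - (1 - \<rho>)) / \<rho> + r / \<rho>" for y
      using \<rho> by (simp add: S1_def pos_le_divide_eq mult.commute flip: add_divide_distrib) linarith
    ultimately show ?thesis by auto
  qed
  ultimately show ?thesis using measure_split[of "{x - r..x + r}"] by simp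
qed

lemma interval_ge_S0:
  "p * measure \<mu> {x / \<rho> - r / \<rho>..x / \<rho> + r / \<rho>} \<le> measure \<mu> {x - r..x + r}"
  unfolding interval_split[of x r] using p by simp

lemma interval_ge_S1:
  "(1 - p) * measure \<mu> {(x - (1 - \<rho>)) / \<rho> - r / \<rho>..(x - (1 - \<rho>)) / \<rho> + r / \<rho>}
     \<le> measure \<mu> {x - r..x + r}"
  unfolding interval_split[of x r] using p by simp

lemma mono_interval_measure: "mono (\<lambda>r. measure \<mu> {x - r..x + r})"
  by (intro monoI finite_measure_mono) auto

section \<open>The local dimension at 0\<close>

text \<open>Keeping only the \<open>S0\<close> branch gives mass at least \<open>p^n\<close> at
  radius \<open>2 * \<rho>^n\<close>. For small radii the \<open>S1\<close> branch has mass 0, which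
  gives a matching upper bound; the two power laws squeeze the quotient.\<close>

lemma has_local_dim_0: "has_local_dim \<mu> 0 (ln p / ln \<rho>)"
proof -
  define f where "f r = measure \<mu> {0 - r..0 + r}" for r
  have mono: "mono f" using mono_interval_measure[of 0] by (simp add: f_def[abs_def])
  have "1 * p ^ n \<le> f (2 * \<rho> ^ n)" for n
  proof (induction n)
    case 0
    show ?case using measure_large_interval[of "-2" 2] by (simp add: f_def)
  next
    case (Suc n)
    have "p * p ^ n \<le> p * f (2 * \<rho> ^ n)" using Suc p by (intro mult_left_mono) auto
    also have "\<dots> \<le> f (2 * \<rho> ^ Suc n)"
      using interval_ge_S0[of 0 "2 * \<rho> ^ Suc n"] \<rho> by (simp add: f_def)
    finally show ?case by simp
  qed
  then obtain C where C: "C > 0" "\<And>r. 0 < r \<Longrightarrow> r \<le> 2 \<Longrightarrow> C * r powr (ln p / ln \<rho>) \<le> f r"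
    using power_law_lower[OF mono \<rho>, of p 1 2] p by auto
  \<comment> \<open>Staying strictly below \<open>1 - \<rho>\<close> keeps the \<open>S1\<close>
    preimage at a positive distance to the left of 0, as \<open>measure_left_zero\<close> requires;
    a possible atom at 0 is thereby avoided.\<close>
  define A where "A = (1 - \<rho>) / 2"
  have A: "0 < A" "A \<le> 2" "A < 1 - \<rho>" using \<rho> by (auto simp: A_def)
  have scale: "f r = p * f (r / \<rho>)" if r: "r \<le> A" for r
  proof -
    have "(0 - (1 - \<rho>) + r) / \<rho> < - ((1 - \<rho> - A) / 2) / \<rho>"
      using r A(3) \<rho>(1) by (intro divide_strict_right_mono) argo+
    then have "(0 - (1 - \<rho>)) / \<rho> + r / \<rho> < - ((1 - \<rho> - A) / 2 / \<rho>)"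
      by (simp add: add_divide_distrib)
    then have "measure \<mu> {(0 - (1 - \<rho>)) / \<rho> - r / \<rho>..(0 - (1 - \<rho>)) / \<rho> + r / \<rho>}
        \<le> measure \<mu> {..< - ((1 - \<rho> - A) / 2 / \<rho>)}"
      by (intro finite_measure_mono) auto
    also have "\<dots> = 0" using A \<rho> by (intro measure_left_zero) auto
    finally show ?thesis
      unfolding f_def interval_split[of 0 r] by (simp add: measure_le_0_iff)
  qed
  have "f (A * \<rho> ^ n) \<le> 1 * p ^ n" for n
  proof (induction n)
    case 0
    show ?case by (simp add: f_def)
  next
    case (Suc n)
    have "A * \<rho> ^ Suc n \<le> A" using A \<rho> by (simp add: power_le_one mult_le_one)
    from scale[OF this] have "f (A * \<rho> ^ Suc n) = p * f (A * \<rho> ^ n)" using \<rho> by simp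
    also have "\<dots> \<le> p * (1 * p ^ n)" using Suc p by (intro mult_left_mono) auto
    finally show ?case by simp
  qed
  then obtain D where D: "D > 0" "\<And>r. 0 < r \<Longrightarrow> r \<le> A \<Longrightarrow> f r \<le> D * r powr (ln p / ln \<rho>)"
    using power_law_upper[OF mono \<rho>, of p 1 A] p A by auto
  \<comment> \<open>Positivity matters because \<open>ln 0 = 0\<close> would break the monotonicity
    of the logarithm.\<close>
  have pos: "0 < f r" if "0 < r" "r \<le> A" for r
    using C(2)[of r] C(1) A that by (smt (verit) mult_pos_pos powr_gt_zero)
  have "((\<lambda>r. ln (f r) / ln r) \<longlongrightarrow> ln p / ln \<rho>) (at_right 0)"
    using eventually_log_quotient_ge[OF A(1) pos D(2)]
      eventually_log_quotient_le[of C 2, OF C(1) _ C(2)]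
      log_power_law_tendsto[OF D(1)] log_power_law_tendsto[OF C(1)]
    by (intro real_tendsto_sandwich[of
          "\<lambda>r. ln (D * r powr (ln p / ln \<rho>)) / ln r" "\<lambda>r. ln (f r) / ln r" _
          "\<lambda>r. ln (C * r powr (ln p / ln \<rho>)) / ln r"]) auto
  then show ?thesis by (simp add: has_local_dim_def f_def)
qed

section \<open>An upper bound for the local dimensions at the other points\<close>

text \<open>The hypothesis \<open>\<rho> ^ j < x\<close> bounds the number of leading zeros in the lazy expansion of \<open>x\<close>,
  and the factor \<open>1 / q ^ j\<close> pays for them.\<close>

lemma interval_measure_ge:
  assumes k: "\<rho> ^ (k + 1) = 2 * \<rho> - 1" and q: "q \<ge> 1" "p * q ^ k = 1 - p"
    and "x \<le> 1" "\<rho> ^ j < x"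
  shows "(p * q) ^ n / q ^ j \<le> measure \<mu> {x - 2 * \<rho> ^ n..x + 2 * \<rho> ^ n}"
  using assms(4,5)
proof (induction n arbitrary: x j)
  case 0
  have "x > 0" using 0 \<rho> zero_less_power[of \<rho> j] by linarith
  then have "measure \<mu> {x - 2..x + 2} = 1"
    using 0 by (intro measure_large_interval) auto
  then show ?case using q by (simp add: one_le_power)
next
  case (Suc n)
  have "j \<noteq> 0" using Suc.prems by (cases j) auto
  then obtain i where j: "j = Suc i" by (cases j) auto
  have r: "2 * \<rho> ^ Suc n / \<rho> = 2 * \<rho> ^ n" using \<rho> by simp
  show ?case
  proof (cases "x \<le> \<rho>")
    case True
    \<comment> \<open>Digit 0: the centre becomes \<open>x / \<rho>\<close>, which exceeds
      \<open>\<rho>^i\<close>, so one fewer zero remains to be paid for. This cancels the extra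
      factor \<open>q\<close>, leaving exactly the weight \<open>p\<close>.\<close>
    have "(p * q) ^ Suc n / q ^ j = p * ((p * q) ^ n / q ^ i)" using q j by simp
    also have "\<dots> \<le> p * measure \<mu> {x / \<rho> - 2 * \<rho> ^ n..x / \<rho> + 2 * \<rho> ^ n}"
      using Suc.prems True p \<rho> j by (intro mult_left_mono Suc.IH) (auto simp: field_simps)
    also have "\<dots> \<le> measure \<mu> {x - 2 * \<rho> ^ Suc n..x + 2 * \<rho> ^ Suc n}"
      using interval_ge_S0[of x "2 * \<rho> ^ Suc n"] unfolding r .
    finally show ?thesis .
  next
    case False
    let ?y = "(x - (1 - \<rho>)) / \<rho>"
    \<comment> \<open>Digit 1: from \<open>x > \<rho>\<close> the new centre exceeds
      \<open>(2 * \<rho> - 1) / \<rho> = \<rho>^k\<close>, so the induction hypothesis applies with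
      the counter reset to \<open>k\<close>.\<close>
    have y: "?y \<le> 1" "\<rho> ^ k < ?y"
      using False k \<rho> Suc.prems by (auto simp: field_simps)
    have "(p * q) ^ Suc n / q ^ j \<le> (p * q) ^ Suc n / q ^ 1"
      using q p j by (intro divide_left_mono power_increasing) auto
    also have "\<dots> = p * (p * q) ^ n" using q by simp
    \<comment> \<open>The choice \<open>p * q^k = 1 - p\<close> makes the larger weight of digit 1
      pay for this reset.\<close>
    also have "\<dots> = (1 - p) * ((p * q) ^ n / q ^ k)"
      using q by (simp flip: q(2))
    also have "\<dots> \<le> (1 - p) * measure \<mu> {?y - 2 * \<rho> ^ n..?y + 2 * \<rho> ^ n}"
      using p y by (intro mult_left_mono Suc.IH) auto
    also have "\<dots> \<le> measure \<mu> {x - 2 * \<rho> ^ Suc n..x + 2 * \<rho> ^ Suc n}"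
      using interval_ge_S1[of x "2 * \<rho> ^ Suc n"] unfolding r .
    finally show ?thesis .
  qed
qed

text \<open>The number \<open>j\<close> depends on \<open>x\<close>, but it enters only the constant
  \<open>1 / q^j\<close> and not the exponent, so the bound is uniform in \<open>x\<close>.\<close>

lemma has_local_dim_le:
  assumes k: "\<rho> ^ (k + 1) = 2 * \<rho> - 1" and q: "q \<ge> 1" "p * q ^ k = 1 - p" "p * q \<le> 1"
    and x: "0 < x" "x \<le> 1" and d: "has_local_dim \<mu> x d"
  shows "d \<le> ln (p * q) / ln \<rho>"
proof -
  let ?f = "\<lambda>r. measure \<mu> {x - r..x + r}"
  obtain j where j: "\<rho> ^ j < x" using real_arch_pow_inv x \<rho> by blast
  have "1 / q ^ j * (p * q) ^ n \<le> ?f (2 * \<rho> ^ n)" for n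
    using interval_measure_ge[OF k q(1,2) x(2) j] by simp
  then obtain C where C: "C > 0"
    "\<And>r. 0 < r \<Longrightarrow> r \<le> 2 \<Longrightarrow> C * r powr (ln (p * q) / ln \<rho>) \<le> ?f r"
    using power_law_lower[OF mono_interval_measure \<rho>, of "p * q" "1 / q ^ j" 2] p q by auto
  show ?thesis
    using log_power_law_tendsto[OF C(1)] d[unfolded has_local_dim_def]
      eventually_log_quotient_le[of C 2, OF C(1) _ C(2)]
    by (intro tendsto_le[OF trivial_limit_at_right_real]) auto
qed

lemma local_dim_0_isolated:
  assumes k: "\<rho> ^ (k + 1) = 2 * \<rho> - 1" "k \<noteq> 0" and lt: "p < 1 - p"
  shows "local_dim_exists \<mu> 0 \<and> local_dim \<mu> 0 isolated_in local_dims \<mu>"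
proof -
  \<comment> \<open>The weight ratio, which exceeds 1, is spread evenly over \<open>k\<close>
    digits.\<close>
  define q where "q = root k ((1 - p) / p)"
  have q1: "q > 1" using k p lt by (simp add: q_def field_simps)
  have qk: "p * q ^ k = 1 - p" using k p by (simp add: q_def)
  have "p * q ^ 1 \<le> p * q ^ k"
    using k q1 p by (intro mult_left_mono power_increasing) auto
  then have pq: "p * q \<le> 1" using qk p by simp
  have ex: "local_dim_exists \<mu> 0" using has_local_dim_0 by (auto simp: local_dim_exists_def)
  have eq: "local_dim \<mu> 0 = ln p / ln \<rho>" using local_dim_eq[OF has_local_dim_0] .
  define e where "e = ln (p * q) / ln \<rho>"
  have "ln p < ln (p * q)" using p q1 by simp
  then have lt: "e < local_dim \<mu> 0"
    unfolding e_def eq using \<rho> by (intro divide_strict_right_mono_neg) auto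
  have mem: "local_dim \<mu> 0 \<in> local_dims \<mu>" using ex by (auto simp: local_dims_def)
  have "d = local_dim \<mu> 0" if d: "d \<in> local_dims \<mu>" "d > e" for d
  proof -
    obtain x where x: "x \<in> {0..1}" "local_dim_exists \<mu> x" "d = local_dim \<mu> x"
      using d by (auto simp: local_dims_def)
    then have "has_local_dim \<mu> x d"
      using local_dim_eq by (auto simp: local_dim_exists_def)
    then have "x = 0"
      using has_local_dim_le[OF k(1) _ qk pq, of x d] d x q1 by (force simp: e_def)
    with x show ?thesis by simp
  qed
  \<comment> \<open>The dimension at 0 lies above \<open>e\<close> and all others are at most
    \<open>e\<close>, so this open ray isolates it.\<close>
  then have "{e<..} \<inter> local_dims \<mu> = {local_dim \<mu> 0}" using lt mem by blast
  with ex mem show ?thesis unfolding isolated_in_def by (metis open_greaterThan)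
qed

end

section \<open>Reflection about 1/2 and the final case distinction\<close>

lemma measure_reflect:
  fixes \<mu> :: "real measure"
  assumes "real_distribution \<mu>" "A \<in> sets borel"
  shows "measure (distr \<mu> borel (\<lambda>x. 1 - x)) A = measure \<mu> ((\<lambda>x. 1 - x) -` A)"
proof -
  interpret real_distribution \<mu> by fact
  show ?thesis using assms by (subst measure_distr) auto
qed

text \<open>Since \<open>1 - S0 \<rho> x = S1 \<rho> (1 - x)\<close>, the reflection interchanges
  the two maps and hence their weights.\<close>

lemma bernoulli_convolution_reflect:
  assumes "bernoulli_convolution \<rho> p \<mu>"
  shows "bernoulli_convolution \<rho> (1 - p) (distr \<mu> borel (\<lambda>x. 1 - x))"
proof -
  interpret real_distribution \<mu> using assms by (simp add: bernoulli_convolution_def)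
  let ?R = "\<lambda>x::real. 1 - x"
  have R: "?R -` A \<in> sets borel" if "A \<in> sets borel" for A
    using measurable_sets[of ?R borel borel A] that by simp
  have "measure (distr \<mu> borel ?R) A =
      (1 - p) * measure (distr \<mu> borel ?R) (S0 \<rho> -` A) +
      (1 - (1 - p)) * measure (distr \<mu> borel ?R) (S1 \<rho> -` A)"
    if A: "A \<in> sets borel" for A
  proof -
    have "S0 \<rho> -` (?R -` A) = ?R -` (S1 \<rho> -` A)" "S1 \<rho> -` (?R -` A) = ?R -` (S0 \<rho> -` A)"
      by (auto simp: S0_def S1_def algebra_simps)
    then show ?thesis
      using assms R[OF A] A S_vimage_borel[OF A] real_distribution_axioms
      by (simp add: bernoulli_convolution_def measure_reflect)
  qed
  moreover have "real_distribution (distr \<mu> borel ?R)"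
    by (rule real_distribution_distr) simp
  ultimately show ?thesis by (simp add: bernoulli_convolution_def)
qed

lemma has_local_dim_reflect:
  assumes "real_distribution \<mu>"
  shows "has_local_dim (distr \<mu> borel (\<lambda>x. 1 - x)) x d \<longleftrightarrow> has_local_dim \<mu> (1 - x) d"
proof -
  have "(\<lambda>y. 1 - y) -` {x - r..x + r} = {(1 - x) - r..(1 - x) + r}" for r by auto
  then show ?thesis by (simp add: has_local_dim_def measure_reflect[OF assms])
qed

theorem theorem4p3:
  fixes \<rho> p :: real and \<mu> :: "real measure"
  assumes "simple_pisot (inverse \<rho>)"
    and "0 < p" and "p < 1" and "p \<noteq> 1 - p"
    and "bernoulli_convolution \<rho> p \<mu>"
  shows "(\<exists>d. d isolated_in local_dims \<mu>) \<and>
         (p < 1 - p \<longrightarrow> local_dim_exists \<mu> 0 \<and> local_dim \<mu> 0 isolated_in local_dims \<mu>) \<and>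
         (1 - p < p \<longrightarrow> local_dim_exists \<mu> 1 \<and> local_dim \<mu> 1 isolated_in local_dims \<mu>)"
proof -
  obtain k where k: "k \<ge> 2" "0 < \<rho>" "\<rho> < 1" "\<rho> ^ (k + 1) = 2 * \<rho> - 1"
    using simple_pisot_inverse_root[OF assms(1)] .
  have left: "local_dim_exists \<mu> 0 \<and> local_dim \<mu> 0 isolated_in local_dims \<mu>" if "p < 1 - p"
  proof -
    interpret biased_convolution \<rho> p \<mu> using assms k by unfold_locales auto
    show ?thesis using local_dim_0_isolated[OF k(4)] k(1) that by simp
  qed
  have right: "local_dim_exists \<mu> 1 \<and> local_dim \<mu> 1 isolated_in local_dims \<mu>" if "1 - p < p"
  proof -
    define \<nu> where "\<nu> = distr \<mu> borel (\<lambda>x. 1 - x)"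
    interpret biased_convolution \<rho> "1 - p" \<nu>
      using assms k bernoulli_convolution_reflect[OF assms(5)]
      by unfold_locales (auto simp: \<nu>_def)
    have rd: "real_distribution \<mu>" using assms(5) by (simp add: bernoulli_convolution_def)
    have hl: "has_local_dim \<nu> x d \<longleftrightarrow> has_local_dim \<mu> (1 - x) d" for x d
      unfolding \<nu>_def by (rule has_local_dim_reflect[OF rd])
    then have ex: "local_dim_exists \<nu> x \<longleftrightarrow> local_dim_exists \<mu> (1 - x)" for x
      by (simp add: local_dim_exists_def)
    have ld: "local_dim \<nu> x = local_dim \<mu> (1 - x)" for x
      by (simp add: local_dim_def hl)
    \<comment> \<open>Isolation concerns the whole set of dimensions; it is unchanged because
      \<open>x \<mapsto> 1 - x\<close> is an involution of [0,1].\<close>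
    have "local_dims \<nu> = local_dims \<mu>"
    proof (intro set_eqI iffI)
      fix d assume "d \<in> local_dims \<nu>"
      then obtain x where "x \<in> {0..1}" "local_dim_exists \<nu> x" "d = local_dim \<nu> x"
        by (auto simp: local_dims_def)
      then show "d \<in> local_dims \<mu>"
        unfolding local_dims_def by (auto simp: ex ld intro!: exI[of _ "1 - x"])
    next
      fix d assume "d \<in> local_dims \<mu>"
      then obtain x where "x \<in> {0..1}" "local_dim_exists \<mu> x" "d = local_dim \<mu> x"
        by (auto simp: local_dims_def)
      then show "d \<in> local_dims \<nu>"
        unfolding local_dims_def by (auto simp: ex ld intro!: exI[of _ "1 - x"])
    qed
    then show ?thesis
      using local_dim_0_isolated[OF k(4)] k(1) that by (simp add: ex ld)
  qed
  from left right assms(4) show ?thesis by (metis linorder_neqE_linordered_idom)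
qed

end
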